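(* Let $d\ge 1$ be an odd integer, $M\ge 1$ and $p\ge 0$ integers, $N=2M+1$, and let $\gamma\ge 0$ be an integrable weighting function on $[0,\pi]$. Assume that the KKT matrix of the optimization problem $(\mathcal P)$ described in the context is invertible, and let $(\mathbf a_d^*,\mathbf b_d^* )\in\mathbb R^N\times\mathbb R^N$ be the (unique) optimal solution of $(\mathcal P)$. Then $\mathbf a_d^*$ is skew-symmetric and $\mathbf b_d^*$ is symmetric about the central element, i.e. $\mathbf J\mathbf a_d^*=-\mathbf a_d^*$ and $\mathbf J\mathbf b_d^*=\mathbf b_d^*$, where $\mathbf J$ is the $N\times N$ anti-diagonal identity matrix (the matrix reversing the order of the entries of a vector).
   Context: Vectors in $\mathbb R^N$, $N=2M+1$, are indexed by $m\in\{-M,\dots,M\}$: $\mathbf a_d=(\mathrm a_{-M},\dots,\mathrm a_M)^T$, $\mathbf b_d=(\mathrm b_{-M},\dots,\mathrm b_M)^T$. These are the coefficients of a compact finite difference scheme $\sum_{m=-M}^M \mathrm b_m f^{(d)}_{i+m}=\frac1{(\Delta x)^d}\sum_{m=-M}^M\mathrm a_m f_{i+m}$ approximating the $d$-th derivative. For $\eta\in[0,\pi]$ put $\mathbf C(\eta)=(\cos(m\eta))_{m=-M}^{M}$ and $\mathbf S(\eta)=(\sin(m\eta))_{m=-M}^{M}$ (column vectors). For odd $d=2q+1$ let $$\mathcal E(\mathbf a_d,\mathbf b_d)=\int_0^\pi \gamma(\eta)\Big[\big(\mathbf C^T(\eta)\mathbf a_d+(-1)^q\eta^d\,\mathbf S^T(\eta)\mathbf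 b_d\big)^2+\big(\mathbf S^T(\eta)\mathbf a_d-(-1)^q\eta^d\,\mathbf C^T(\eta)\mathbf b_d\big)^2\Big]d\eta=\begin{pmatrix}\mathbf a_d\\ \mathbf b_d\end{pmatrix}^T\mathbf Q_d\begin{pmatrix}\mathbf a_d\\ \mathbf b_d\end{pmatrix},$$ where $\mathbf Q_d$ is the symmetric $2N\times 2N$ matrix of this quadratic form. Problem $(\mathcal P)$: minimize $\mathcal E(\mathbf a_d,\mathbf b_d)$ over $\mathbf a_d,\mathbf b_d\in\mathbb R^N$ subject to the linear constraints (with the convention $0^0=1$) - $\sum_{m=-M}^M \mathrm a_m m^k=0$ for $k=0,\dots,d-1$; - $\sum_{m=-M}^M\left(\frac{m^{d+r}}{(d+r)!}\mathrm a_m-\frac{m^r}{r!}\mathrm b_m\right)=0$ for $r=0,\dots,p$; - $\mathrm b_0=1$. Let $\mathbf K$ be the $(d+p+2)\times 2N$ matrix whose rows are the coefficient vectors of these $d+p+2$ linear constraints acting on $(\mathbf a_d^T,\mathbf b_d^T)^T$. The KKT matrix of $(\mathcal P)$ is $\begin{bmatrix}\mathbf Q_d&\mathbf K^T\\ \mathbf K&\mathbf 0\end{bmatrix}$. *)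

theory Defs
  imports "HOL-Analysis.Analysis" "Jordan_Normal_Form.Matrix"
begin

unbundle no inner_syntax and no vec_syntax

text \<open>
  Vectors indexed by \<open>m \<in> {-M..M}\<close> are vectors of dimension \<open>2 * M + 1\<close>; position \<open>i\<close> holds
  the entry with index \<open>m = i - M\<close>.
\<close>

definition offset :: "nat \<Rightarrow> nat \<Rightarrow> real" where
  "offset M i = real i - real M"

definition Cvec :: "nat \<Rightarrow> real \<Rightarrow> real vec" where
  "Cvec M \<eta> = vec (2 * M + 1) (\<lambda>i. cos (offset M i * \<eta>))"

definition Svec :: "nat \<Rightarrow> real \<Rightarrow> real vec" where
  "Svec M \<eta> = vec (2 * M + 1) (\<lambda>i. sin (offset M i * \<eta>))"

text \<open>The derivative order is \<open>d = 2 * q + 1\<close>, so that \<open>q = d div 2\<close>.\<close>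

definition objective :: "(real \<Rightarrow> real) \<Rightarrow> nat \<Rightarrow> nat \<Rightarrow> real vec \<Rightarrow> real vec \<Rightarrow> real" where
  "objective \<gamma> M d a b =
    (LINT \<eta>:{0..pi}|lebesgue. \<gamma> \<eta> *
      ((Cvec M \<eta> \<bullet> a + (-1) ^ (d div 2) * \<eta> ^ d * (Svec M \<eta> \<bullet> b))\<^sup>2 +
       (Svec M \<eta> \<bullet> a - (-1) ^ (d div 2) * \<eta> ^ d * (Cvec M \<eta> \<bullet> b))\<^sup>2))"

text \<open>
  The two squared linear forms of the integrand have the coefficient vectors \<open>form1\<close> and \<open>form2\<close>.
  The matrix \<open>Qmat\<close> obtained from them is characterised by \<open>Qmat_symmetric\<close>,
  \<open>objective_eq_Qmat\<close> and \<open>Qmat_unique\<close> below as the symmetric matrix of the quadratic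
  form \<open>objective\<close>.
\<close>

definition form1 :: "nat \<Rightarrow> nat \<Rightarrow> real \<Rightarrow> real vec" where
  "form1 M d \<eta> = Cvec M \<eta> @\<^sub>v (((-1) ^ (d div 2) * \<eta> ^ d) \<cdot>\<^sub>v Svec M \<eta>)"

definition form2 :: "nat \<Rightarrow> nat \<Rightarrow> real \<Rightarrow> real vec" where
  "form2 M d \<eta> = Svec M \<eta> @\<^sub>v ((- ((-1) ^ (d div 2) * \<eta> ^ d)) \<cdot>\<^sub>v Cvec M \<eta>)"

definition Qmat :: "(real \<Rightarrow> real) \<Rightarrow> nat \<Rightarrow> nat \<Rightarrow> real mat" where
  "Qmat \<gamma> M d = mat (2 * (2 * M + 1)) (2 * (2 * M + 1))
    (\<lambda>(i, j). LINT \<eta>:{0..pi}|lebesgue. \<gamma> \<eta> *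
      (form1 M d \<eta> $ i * form1 M d \<eta> $ j + form2 M d \<eta> $ i * form2 M d \<eta> $ j))"

definition feasible :: "nat \<Rightarrow> nat \<Rightarrow> nat \<Rightarrow> real vec \<Rightarrow> real vec \<Rightarrow> bool" where
  "feasible M d p a b \<longleftrightarrow>
    a \<in> carrier_vec (2 * M + 1) \<and> b \<in> carrier_vec (2 * M + 1) \<and>
    (\<forall>k<d. (\<Sum>i<2 * M + 1. a $ i * offset M i ^ k) = 0) \<and>
    (\<forall>r\<le>p. (\<Sum>i<2 * M + 1. offset M i ^ (d + r) / fact (d + r) * a $ i
                           - offset M i ^ r / fact r * b $ i) = 0) \<and>
    b $ M = 1"

definition optimal :: "(real \<Rightarrow> real) \<Rightarrow> nat \<Rightarrow> nat \<Rightarrow> nat \<Rightarrow> real vec \<Rightarrow> real vec \<Rightarrow> bool" where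
  "optimal \<gamma> M d p a b \<longleftrightarrow> feasible M d p a b \<and>
    (\<forall>a' b'. feasible M d p a' b' \<longrightarrow> objective \<gamma> M d a b \<le> objective \<gamma> M d a' b')"

text \<open>
  Rows \<open>0..d-1\<close> are the moment conditions on \<open>a\<close>, rows \<open>d..d+p\<close> the mixed conditions with
  \<open>r = row - d\<close>, and row \<open>d+p+1\<close> the normalisation of the central entry of \<open>b\<close>;
  see \<open>feasible_iff_Kmat\<close> below.
\<close>

definition Kmat :: "nat \<Rightarrow> nat \<Rightarrow> nat \<Rightarrow> real mat" where
  "Kmat M d p = mat (d + p + 2) (2 * (2 * M + 1))
    (\<lambda>(k, j). let N = 2 * M + 1 in
      if k < d then (if j < N then offset M j ^ k else 0)
      else if k \<le> d + p then
        (if j < N then offset M j ^ k / fact k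
         else - (offset M (j - N) ^ (k - d) / fact (k - d)))
      else (if j = N + M then 1 else 0))"

definition KKT_mat :: "(real \<Rightarrow> real) \<Rightarrow> nat \<Rightarrow> nat \<Rightarrow> nat \<Rightarrow> real mat" where
  "KKT_mat \<gamma> M d p =
    four_block_mat (Qmat \<gamma> M d) (transpose_mat (Kmat M d p))
                   (Kmat M d p) (0\<^sub>m (d + p + 2) (d + p + 2))"

definition exchange_mat :: "nat \<Rightarrow> real mat" where
  "exchange_mat N = mat N N (\<lambda>(i, j). if i + j + 1 = N then 1 else 0)"

lemma exchange_mat_mult_vec:
  assumes "v \<in> carrier_vec N"
  shows "exchange_mat N *\<^sub>v v = vec N (\<lambda>i. v $ (N - 1 - i))"
proof (rule eq_vecI)
  fix i assume "i < dim_vec (vec N (\<lambda>i. v $ (N - 1 - i)))"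
  then have i: "i < N" by simp
  have "(exchange_mat N *\<^sub>v v) $ i = (\<Sum>j<N. (if i + j + 1 = N then 1 else 0) * v $ j)"
    using i assms by (simp add: exchange_mat_def scalar_prod_def lessThan_atLeast0)
  also have "\<dots> = (\<Sum>j<N. if j = N - 1 - i then v $ j else 0)"
    using i by (intro sum.cong) auto
  also have "\<dots> = v $ (N - 1 - i)" using i by simp
  finally show "(exchange_mat N *\<^sub>v v) $ i = vec N (\<lambda>i. v $ (N - 1 - i)) $ i" using i by simp
qed (simp add: exchange_mat_def)

lemma Qmat_carrier: "Qmat \<gamma> M d \<in> carrier_mat (2 * (2 * M + 1)) (2 * (2 * M + 1))"
  by (simp add: Qmat_def)

lemma Qmat_symmetric: "transpose_mat (Qmat \<gamma> M d) = Qmat \<gamma> M d"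
  by (rule eq_matI) (auto simp: Qmat_def mult.commute)

lemma scalar_prod_lessThan: "v \<bullet> w = (\<Sum>i<dim_vec w. v $ i * w $ i)"
  by (simp add: scalar_prod_def lessThan_atLeast0)

lemma quadratic_form_sum:
  fixes A :: "real mat"
  assumes "A \<in> carrier_mat n n" "x \<in> carrier_vec n"
  shows "x \<bullet> (A *\<^sub>v x) = (\<Sum>i<n. \<Sum>j<n. x $ i * x $ j * A $$ (i, j))"
  using assms by (simp add: scalar_prod_lessThan sum_distrib_left mult_ac)

lemma objective_eq_Qmat:
  assumes int: "set_integrable lebesgue {0..pi} \<gamma>"
    and a: "a \<in> carrier_vec (2 * M + 1)" and b: "b \<in> carrier_vec (2 * M + 1)"
  shows "objective \<gamma> M d a b = (a @\<^sub>v b) \<bullet> (Qmat \<gamma> M d *\<^sub>v (a @\<^sub>v b))"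
proof -
  define n where "n = 2 * (2 * M + 1)"
  define x where "x = a @\<^sub>v b"
  have x: "x \<in> carrier_vec n" using a b unfolding x_def n_def by (intro carrier_vecI) simp
  define f where "f i j \<eta> = form1 M d \<eta> $ i * form1 M d \<eta> $ j + form2 M d \<eta> $ i * form2 M d \<eta> $ j"
    for i j \<eta>
  have dims: "Cvec M \<eta> \<in> carrier_vec (2 * M + 1)" "Svec M \<eta> \<in> carrier_vec (2 * M + 1)" for \<eta>
    by (simp_all add: Cvec_def Svec_def)
  have 1: "form1 M d \<eta> \<bullet> x = Cvec M \<eta> \<bullet> a + (-1) ^ (d div 2) * \<eta> ^ d * (Svec M \<eta> \<bullet> b)" for \<eta>
    unfolding form1_def x_def using a b dims[of \<eta>]
    by (subst scalar_prod_append[of _ "2*M+1" _ "2*M+1"]) (auto simp: smult_scalar_prod_distrib)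
  have 2: "form2 M d \<eta> \<bullet> x = Svec M \<eta> \<bullet> a - (-1) ^ (d div 2) * \<eta> ^ d * (Cvec M \<eta> \<bullet> b)" for \<eta>
    unfolding form2_def x_def using a b dims[of \<eta>]
    by (subst scalar_prod_append[of _ "2*M+1" _ "2*M+1"]) (auto simp: smult_scalar_prod_distrib)
  have cont: "continuous_on {0..pi} (f i j)" if "i < n" "j < n" for i j
  proof -
    have c1: "continuous_on {0..pi} (\<lambda>\<eta>. form1 M d \<eta> $ i)" if "i < n" for i
      using that unfolding form1_def Cvec_def Svec_def n_def
      by (cases "i < 2 * M + 1") (auto intro!: continuous_intros)
    have c2: "continuous_on {0..pi} (\<lambda>\<eta>. form2 M d \<eta> $ i)" if "i < n" for i
      using that unfolding form2_def Cvec_def Svec_def n_def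
      by (cases "i < 2 * M + 1") (auto intro!: continuous_intros)
    show ?thesis unfolding f_def using that by (intro continuous_intros c1 c2)
  qed
  have intf: "set_integrable lebesgue {0..pi} (\<lambda>\<eta>. \<gamma> \<eta> * f i j \<eta>)" if "i < n" "j < n" for i j
  proof -
    have "(\<lambda>\<eta>. f i j \<eta> * \<gamma> \<eta>) absolutely_integrable_on {0..pi}"
    proof (rule absolutely_integrable_bounded_measurable_product_real)
      show "f i j \<in> borel_measurable (lebesgue_on {0..pi})"
        by (intro continuous_imp_measurable_on_sets_lebesgue cont that) auto
      show "bounded (f i j ` {0..pi})"
        by (intro compact_imp_bounded compact_continuous_image cont that) auto
    qed (use int in auto)
    then show ?thesis by (simp add: mult.commute)
  qed
  have sq: "(\<Sum>i<n. u $ i * x $ i)\<^sup>2 = (\<Sum>i<n. \<Sum>j<n. x $ i * x $ j * (u $ i * u $ j))" for u :: "real vec"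
    by (simp add: power2_eq_square sum_product mult_ac)
  have "(form1 M d \<eta> \<bullet> x)\<^sup>2 + (form2 M d \<eta> \<bullet> x)\<^sup>2 = (\<Sum>i<n. \<Sum>j<n. x $ i * x $ j * f i j \<eta>)" for \<eta>
    using x by (simp add: scalar_prod_lessThan sq f_def sum.distrib distrib_left)
  then have "objective \<gamma> M d a b =
      (LINT \<eta>:{0..pi}|lebesgue. (\<Sum>i<n. \<Sum>j<n. x $ i * x $ j * (\<gamma> \<eta> * f i j \<eta>)))"
    unfolding objective_def 1[symmetric] 2[symmetric]
    by (simp add: sum_distrib_left mult_ac)
  also have "\<dots> = (\<Sum>i<n. \<Sum>j<n. x $ i * x $ j * (LINT \<eta>:{0..pi}|lebesgue. \<gamma> \<eta> * f i j \<eta>))"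
  proof -
    define g where "g i j \<eta> = indicator {0..pi} \<eta> *\<^sub>R (\<gamma> \<eta> * f i j \<eta>)" for i j \<eta>
    have intg: "integrable lebesgue (g i j)" if "i < n" "j < n" for i j
      using intf[OF that] unfolding set_integrable_def g_def .
    have "(LINT \<eta>:{0..pi}|lebesgue. (\<Sum>i<n. \<Sum>j<n. x $ i * x $ j * (\<gamma> \<eta> * f i j \<eta>))) =
        (LINT \<eta>|lebesgue. (\<Sum>i<n. \<Sum>j<n. x $ i * x $ j * g i j \<eta>))"
      unfolding set_lebesgue_integral_def g_def
      by (intro Bochner_Integration.integral_cong) (simp_all add: sum_distrib_left mult_ac)
    also have "\<dots> = (\<Sum>i<n. \<Sum>j<n. x $ i * x $ j * (LINT \<eta>|lebesgue. g i j \<eta>))"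
    proof (subst Bochner_Integration.integral_sum)
      show "integrable lebesgue (\<lambda>\<eta>. \<Sum>j<n. x $ i * x $ j * g i j \<eta>)" if "i \<in> {..<n}" for i
        using that intg
        by (intro Bochner_Integration.integrable_sum Bochner_Integration.integrable_mult_right) auto
      show "(\<Sum>i<n. (LINT \<eta>|lebesgue. (\<Sum>j<n. x $ i * x $ j * g i j \<eta>))) =
          (\<Sum>i<n. \<Sum>j<n. x $ i * x $ j * (LINT \<eta>|lebesgue. g i j \<eta>))"
      proof (intro sum.cong refl)
        fix i assume "i \<in> {..<n}"
        then show "(LINT \<eta>|lebesgue. (\<Sum>j<n. x $ i * x $ j * g i j \<eta>)) =
            (\<Sum>j<n. x $ i * x $ j * (LINT \<eta>|lebesgue. g i j \<eta>))"
          using intg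
          by (subst Bochner_Integration.integral_sum)
            (auto intro!: Bochner_Integration.integrable_mult_right)
      qed
    qed
    finally show ?thesis unfolding set_lebesgue_integral_def g_def .
  qed
  also have "\<dots> = x \<bullet> (Qmat \<gamma> M d *\<^sub>v x)"
    using x Qmat_carrier[of \<gamma> M d]
    by (subst quadratic_form_sum[of _ n]) (auto simp: Qmat_def n_def f_def intro!: sum.cong)
  finally show ?thesis unfolding x_def .
qed

lemma Qmat_unique:
  assumes int: "set_integrable lebesgue {0..pi} \<gamma>"
    and P: "P \<in> carrier_mat (2 * (2 * M + 1)) (2 * (2 * M + 1))" and sym: "transpose_mat P = P"
    and form: "\<And>a b. a \<in> carrier_vec (2 * M + 1) \<Longrightarrow> b \<in> carrier_vec (2 * M + 1) \<Longrightarrow>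
      objective \<gamma> M d a b = (a @\<^sub>v b) \<bullet> (P *\<^sub>v (a @\<^sub>v b))"
  shows "P = Qmat \<gamma> M d"
proof -
  define n where "n = 2 * (2 * M + 1)"
  define Q where "Q = Qmat \<gamma> M d"
  have P': "P \<in> carrier_mat n n" and Q': "Q \<in> carrier_mat n n"
    using P Qmat_carrier unfolding n_def Q_def by auto
  have eq: "x \<bullet> (P *\<^sub>v x) = x \<bullet> (Q *\<^sub>v x)" if x: "x \<in> carrier_vec n" for x
  proof -
    define a b where "a = vec_first x (2 * M + 1)" and "b = vec_last x (2 * M + 1)"
    have "x = a @\<^sub>v b" "a \<in> carrier_vec (2 * M + 1)" "b \<in> carrier_vec (2 * M + 1)"
      using x vec_first_last_append[of x "2 * M + 1" "2 * M + 1"] unfolding a_def b_def n_def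
      by (simp_all add: mult_2)
    then show ?thesis using form objective_eq_Qmat[OF int] unfolding Q_def by metis
  qed
  have unit: "unit_vec n i \<bullet> (A *\<^sub>v unit_vec n j) = A $$ (i, j)"
    if "A \<in> carrier_mat n n" "i < n" "j < n" for A :: "real mat" and i j
    using that by simp
  have polar: "(unit_vec n i + unit_vec n j) \<bullet> (A *\<^sub>v (unit_vec n i + unit_vec n j)) =
      A $$ (i, i) + A $$ (i, j) + A $$ (j, i) + A $$ (j, j)"
    if A: "A \<in> carrier_mat n n" and "i < n" "j < n" for A :: "real mat" and i j
  proof -
    have u: "unit_vec n k \<in> carrier_vec n" "A *\<^sub>v unit_vec n k \<in> carrier_vec n" for k
      using A by auto
    show ?thesis
      using that u
      by (simp only: mult_add_distrib_mat_vec[OF A u(1) u(1)] add_scalar_prod_distrib[OF u(1) u(1)]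
          scalar_prod_add_distrib[OF u(1) u(2) u(2)] unit add_carrier_vec)
  qed
  have sym': "A $$ (j, i) = A $$ (i, j)"
    if "transpose_mat A = A" "A \<in> carrier_mat n n" "i < n" "j < n" for A :: "real mat" and i j
    using that by (metis carrier_matD index_transpose_mat(1))
  have "P $$ (i, j) = Q $$ (i, j)" if ij: "i < n" "j < n" for i j
  proof -
    have diag: "P $$ (k, k) = Q $$ (k, k)" if "k < n" for k
      using eq[of "unit_vec n k"] unit[OF P' that that] unit[OF Q' that that] by simp
    have "P $$ (i, i) + P $$ (i, j) + P $$ (j, i) + P $$ (j, j) =
          Q $$ (i, i) + Q $$ (i, j) + Q $$ (j, i) + Q $$ (j, j)"
      using eq[of "unit_vec n i + unit_vec n j"] polar[OF P' ij] polar[OF Q' ij] by simp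
    then show ?thesis
      using diag ij sym'[OF sym P' ij] sym'[OF Qmat_symmetric[of \<gamma> M d, folded Q_def] Q' ij] by simp
  qed
  then show ?thesis using P' Q' unfolding Q_def[symmetric] by (intro eq_matI) auto
qed

lemma feasible_iff_Kmat:
  assumes a: "a \<in> carrier_vec (2 * M + 1)" and b: "b \<in> carrier_vec (2 * M + 1)"
  shows "feasible M d p a b \<longleftrightarrow> Kmat M d p *\<^sub>v (a @\<^sub>v b) = unit_vec (d + p + 2) (d + p + 1)"
proof -
  define N where "N = 2 * M + 1"
  let ?v = "Kmat M d p *\<^sub>v (a @\<^sub>v b)"
  have halves: "(\<Sum>j<2 * N. f j) = (\<Sum>j<N. f j) + (\<Sum>j<N. f (N + j))" for f :: "nat \<Rightarrow> real"
    using sum.nat_group[of f N 2] by (simp add: numeral_2_eq_2 lessThan_atLeast0 sum.shift_bounds_nat_ivl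
        flip: sum.atLeastLessThan_concat[of 0 N "N + N" f] add: sum.atLeastLessThan_shift_0[of f N])
  have dimK: "dim_row (Kmat M d p) = d + p + 2" by (simp add: Kmat_def)
  have ent: "?v $ k = (\<Sum>j<N. Kmat M d p $$ (k, j) * a $ j) + (\<Sum>j<N. Kmat M d p $$ (k, N + j) * b $ j)"
    if "k < d + p + 2" for k
  proof -
    have "?v $ k = (\<Sum>j<2 * N. Kmat M d p $$ (k, j) * (a @\<^sub>v b) $ j)"
      using that a b by (simp add: Kmat_def scalar_prod_lessThan N_def mult_2)
    then show ?thesis unfolding halves using a b by (simp add: N_def)
  qed
  have r1: "?v $ k = (\<Sum>i<N. a $ i * offset M i ^ k)" if "k < d" for k
    using that by (subst ent) (auto simp: Kmat_def N_def mult.commute)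
  have r2: "?v $ (d + r) = (\<Sum>i<N. offset M i ^ (d + r) / fact (d + r) * a $ i
                           - offset M i ^ r / fact r * b $ i)" if "r \<le> p" for r
    using that by (subst ent) (auto simp: Kmat_def N_def sum_subtractf sum_negf)
  have r3: "?v $ (d + p + 1) = b $ M"
    by (subst ent) (auto simp: Kmat_def N_def if_distrib[of "\<lambda>c. c * _"] cong: if_cong)
  have "?v = unit_vec (d + p + 2) (d + p + 1) \<longleftrightarrow>
      (\<forall>k<d + p + 2. ?v $ k = (if k = d + p + 1 then 1 else 0))"
    by (auto simp: vec_eq_iff dimK unit_vec_def)
  also have "\<dots> \<longleftrightarrow> (\<forall>k<d. ?v $ k = 0) \<and> (\<forall>r\<le>p. ?v $ (d + r) = 0) \<and> ?v $ (d + p + 1) = 1"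
  proof (intro iffI conjI allI impI)
    fix k
    assume *: "(\<forall>k<d. ?v $ k = 0) \<and> (\<forall>r\<le>p. ?v $ (d + r) = 0) \<and> ?v $ (d + p + 1) = 1"
      and "k < d + p + 2"
    then consider "k < d" | r where "k = d + r" "r \<le> p" | "k = d + p + 1"
      by (metis Suc_1 Suc_eq_plus1 add_Suc_right add_le_cancel_left le_add_diff_inverse less_Suc_eq
          less_Suc_eq_le not_less)
    then show "?v $ k = (if k = d + p + 1 then 1 else 0)" using * by cases auto
  qed auto
  also have "\<dots> \<longleftrightarrow> feasible M d p a b"
    using a b by (simp add: feasible_def r1 r2 r3[simplified] N_def)
  finally show ?thesis by simp
qed

end

theory Submission
  imports Defs
begin

text \<open>
  The problem has a reflection symmetry: for odd \<open>d\<close> the map \<open>(a, b) \<mapsto> (- J a, J b)\<close>, with \<open>J\<close>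
  reversing the order of the entries, sends feasible points to feasible points and does not change
  the objective. The reason is parity. The vector \<open>C(\<eta>)\<close> is symmetric and \<open>S(\<eta>)\<close> is
  skew-symmetric, so the first linear form in the objective changes its sign and the second one is
  kept; the \<open>k\<close>-th moment of \<open>J v\<close> is \<open>(-1) ^ k\<close> times that of \<open>v\<close>, so each homogeneous
  constraint is only multiplied by a sign, and the central entry of \<open>b\<close> stays in place
  (\<open>optimal_reflect\<close>). Hence, once the optimal solution is unique, it is a fixed point of the
  map, which is the claim.

  Existence and uniqueness hold for any convex quadratic program with equality constraints
  whose KKT matrix is invertible (\<open>invertible_KKT_imp_unique_minimizer\<close>). The solution of the
  KKT equations is a minimizer because the gradient there is orthogonal to all feasible
  directions and the form is positive semidefinite. A second minimizer would differ from it by a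
  direction \<open>h\<close> with \<open>K h = 0\<close> on which the form vanishes; semidefiniteness then gives
  \<open>Q h = 0\<close>, so \<open>(h, 0)\<close> lies in the kernel of the KKT matrix and \<open>h = 0\<close>.
\<close>

section \<open>Equality-constrained convex quadratic programs\<close>

lemma symmetric_mat_scalar_prod:
  fixes A :: "real mat"
  assumes "A \<in> carrier_mat n n" "transpose_mat A = A" "x \<in> carrier_vec n" "y \<in> carrier_vec n"
  shows "y \<bullet> (A *\<^sub>v x) = x \<bullet> (A *\<^sub>v y)"
proof -
  have "y \<bullet> (A *\<^sub>v x) = (A *\<^sub>v y) \<bullet> x"
    using transpose_vec_mult_scalar[OF assms(1,3,4)] assms(2) by simp
  also have "\<dots> = x \<bullet> (A *\<^sub>v y)"
    using assms by (intro comm_scalar_prod[of _ n]) auto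
  finally show ?thesis .
qed

lemma quadratic_form_add:
  fixes Q :: "real mat"
  assumes Q: "Q \<in> carrier_mat n n" "transpose_mat Q = Q"
    and x: "x \<in> carrier_vec n" and h: "h \<in> carrier_vec n"
  shows "(x + h) \<bullet> (Q *\<^sub>v (x + h)) = x \<bullet> (Q *\<^sub>v x) + 2 * (h \<bullet> (Q *\<^sub>v x)) + h \<bullet> (Q *\<^sub>v h)"
proof -
  have Qx: "Q *\<^sub>v x \<in> carrier_vec n" and Qh: "Q *\<^sub>v h \<in> carrier_vec n"
    using Q x h by auto
  have "(x + h) \<bullet> (Q *\<^sub>v (x + h)) = (x + h) \<bullet> (Q *\<^sub>v x + Q *\<^sub>v h)"
    using mult_add_distrib_mat_vec[OF Q(1) x h] by simp
  also have "\<dots> = x \<bullet> (Q *\<^sub>v x) + x \<bullet> (Q *\<^sub>v h) + (h \<bullet> (Q *\<^sub>v x) + h \<bullet> (Q *\<^sub>v h))"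
    using x h Qx Qh
    by (simp add: add_scalar_prod_distrib[of _ n] scalar_prod_add_distrib[of _ n])
  finally show ?thesis
    using symmetric_mat_scalar_prod[OF Q x h] by simp
qed

text \<open>
  A zero of a semidefinite form is a minimum of it, so the gradient vanishes there: if \<open>Q h \<noteq> 0\<close>,
  then a small step from \<open>h\<close> against \<open>Q h\<close> would make the form negative.
\<close>

lemma psd_form_zero_imp_kernel:
  fixes Q :: "real mat"
  assumes Q: "Q \<in> carrier_mat n n" "transpose_mat Q = Q"
    and psd: "\<And>x. x \<in> carrier_vec n \<Longrightarrow> 0 \<le> x \<bullet> (Q *\<^sub>v x)"
    and h: "h \<in> carrier_vec n" and zero: "h \<bullet> (Q *\<^sub>v h) = 0"
  shows "Q *\<^sub>v h = 0\<^sub>v n"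
proof -
  define w where "w = Q *\<^sub>v h"
  have w: "w \<in> carrier_vec n" using Q h by (simp add: w_def)
  define s where "s = w \<bullet> w"
  define c where "c = w \<bullet> (Q *\<^sub>v w)"
  have c: "0 \<le> c" using psd[OF w] by (simp add: c_def)
  have s: "0 \<le> s" by (simp add: s_def scalar_prod_def sum_nonneg)
  have Qw: "Q *\<^sub>v w \<in> carrier_vec n" using Q w by simp
  have step: "0 \<le> t * (2 * s + t * c)" for t
  proof -
    have tw: "t \<cdot>\<^sub>v w \<in> carrier_vec n" using w by simp
    have "0 \<le> (h + t \<cdot>\<^sub>v w) \<bullet> (Q *\<^sub>v (h + t \<cdot>\<^sub>v w))" using h tw by (intro psd) simp
    also have "\<dots> = t * (2 * s + t * c)"
      using w Qw
      by (simp add: quadratic_form_add[OF Q h tw] zero[folded w_def] mult_mat_vec[OF Q(1) w] s_def c_def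
          flip: w_def) (simp add: algebra_simps)
    finally show ?thesis .
  qed
  have "s = 0"
  proof (rule ccontr)
    assume "s \<noteq> 0"
    then have "0 < s" using s by simp
    (* The step is short enough that the curvature c cannot outweigh the linear decrease;
       adding 1 covers c = 0. *)
    define t where "t = s / (c + 1)"
    have t: "0 < t" "t * c \<le> s" using \<open>0 < s\<close> c by (simp_all add: t_def field_simps)
    then have "0 < t * (2 * s - t * c)" using \<open>0 < s\<close> by simp
    then show False using step[of "- t"] by simp
  qed
  then have "w \<bullet>c w = 0" by (simp add: s_def)
  then have "w = 0\<^sub>v n" by (rule iffD1[OF conjugate_square_eq_0_vec[OF w]])
  then show ?thesis by (simp add: w_def)
qed

lemma invertible_mat_solve:
  assumes A: "A \<in> carrier_mat n n" and inv: "invertible_mat A" and b: "b \<in> carrier_vec n"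
  shows "\<exists>!x. x \<in> carrier_vec n \<and> A *\<^sub>v x = b"
proof -
  obtain B where AB: "A * B = 1\<^sub>m n" and BA: "B * A = 1\<^sub>m (dim_row B)"
    using inv A unfolding invertible_mat_def inverts_mat_def by auto
  have "dim_col (A * B) = n" "dim_col (B * A) = dim_row B" using AB BA by simp_all
  then have B: "B \<in> carrier_mat n n" using A by auto
  show ?thesis
  proof (rule ex1I[of _ "B *\<^sub>v b"])
    show "B *\<^sub>v b \<in> carrier_vec n \<and> A *\<^sub>v (B *\<^sub>v b) = b"
      using A B b AB by (simp flip: assoc_mult_mat_vec)
    show "x = B *\<^sub>v b" if "x \<in> carrier_vec n \<and> A *\<^sub>v x = b" for x
      using that A B BA assoc_mult_mat_vec[OF B A, of x] by auto
  qed
qed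

text \<open>
  The blocks of the KKT system express stationarity, \<open>Q x + K\<^sup>T l = 0\<close> with a multiplier \<open>l\<close>, and
  feasibility, \<open>K x = c\<close>. Stationarity makes \<open>Q x\<close> orthogonal to the kernel of \<open>K\<close>, so at the
  feasible point \<open>x + h\<close> the form exceeds its value at \<open>x\<close> by exactly \<open>h \<bullet> Q h\<close>.
\<close>

lemma invertible_KKT_imp_unique_minimizer:
  fixes Q K :: "real mat"
  assumes Q: "Q \<in> carrier_mat n n" "transpose_mat Q = Q"
    and psd: "\<And>x. x \<in> carrier_vec n \<Longrightarrow> 0 \<le> x \<bullet> (Q *\<^sub>v x)"
    and K: "K \<in> carrier_mat k n"
    and inv: "invertible_mat (four_block_mat Q (transpose_mat K) K (0\<^sub>m k k))"
    and c: "c \<in> carrier_vec k"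
  shows "\<exists>!x. x \<in> carrier_vec n \<and> K *\<^sub>v x = c \<and>
    (\<forall>y\<in>carrier_vec n. K *\<^sub>v y = c \<longrightarrow> x \<bullet> (Q *\<^sub>v x) \<le> y \<bullet> (Q *\<^sub>v y))"
proof -
  let ?A = "four_block_mat Q (transpose_mat K) K (0\<^sub>m k k)"
  have A: "?A \<in> carrier_mat (n + k) (n + k)" using Q(1) by (intro four_block_carrier_mat) auto
  have KT: "transpose_mat K \<in> carrier_mat n k" using K by simp
  have A_mult: "?A *\<^sub>v (x @\<^sub>v l) = (Q *\<^sub>v x + transpose_mat K *\<^sub>v l) @\<^sub>v (K *\<^sub>v x)"
    if "x \<in> carrier_vec n" "l \<in> carrier_vec k" for x l
  proof -
    have "K *\<^sub>v x \<in> carrier_vec k" "0\<^sub>m k k *\<^sub>v l = 0\<^sub>v k" using K that by auto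
    then show ?thesis
      using four_block_mat_mult_vec[OF Q(1) KT K, of "0\<^sub>m k k" x l] that by simp
  qed
  have "0\<^sub>v n @\<^sub>v c \<in> carrier_vec (n + k)" using c by simp
  then obtain z where z: "z \<in> carrier_vec (n + k)" "?A *\<^sub>v z = 0\<^sub>v n @\<^sub>v c"
    using invertible_mat_solve[OF A inv] by blast
  define x where "x = vec_first z n"
  define l where "l = vec_last z k"
  have x: "x \<in> carrier_vec n" and l: "l \<in> carrier_vec k" and "z = x @\<^sub>v l"
    using z(1) by (simp_all add: x_def l_def)
  then have "(Q *\<^sub>v x + transpose_mat K *\<^sub>v l) @\<^sub>v (K *\<^sub>v x) = 0\<^sub>v n @\<^sub>v c"
    using z(2) A_mult by simp
  moreover have "Q *\<^sub>v x + transpose_mat K *\<^sub>v l \<in> carrier_vec n" using Q x KT l by simp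
  ultimately have grad: "Q *\<^sub>v x + transpose_mat K *\<^sub>v l = 0\<^sub>v n" and Kx: "K *\<^sub>v x = c"
    by (metis append_vec_eq zero_carrier_vec)+
  have orth: "h \<bullet> (Q *\<^sub>v x) = 0" if h: "h \<in> carrier_vec n" "K *\<^sub>v h = 0\<^sub>v k" for h
  proof -
    have Qx: "Q *\<^sub>v x \<in> carrier_vec n" and KTl: "transpose_mat K *\<^sub>v l \<in> carrier_vec n"
      using Q x KT l by simp_all
    have "0 = h \<bullet> (Q *\<^sub>v x + transpose_mat K *\<^sub>v l)" using h grad by simp
    also have "\<dots> = h \<bullet> (Q *\<^sub>v x) + h \<bullet> (transpose_mat K *\<^sub>v l)"
      by (rule scalar_prod_add_distrib[OF h(1) Qx KTl])
    also have "h \<bullet> (transpose_mat K *\<^sub>v l) = (transpose_mat K *\<^sub>v l) \<bullet> h"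
      by (rule comm_scalar_prod[OF h(1) KTl])
    also have "\<dots> = 0" using transpose_vec_mult_scalar[OF K h(1) l] h l by simp
    finally show ?thesis by simp
  qed
  have diff: "y - x \<in> carrier_vec n" "K *\<^sub>v (y - x) = 0\<^sub>v k"
    "y \<bullet> (Q *\<^sub>v y) = x \<bullet> (Q *\<^sub>v x) + (y - x) \<bullet> (Q *\<^sub>v (y - x))"
    if y: "y \<in> carrier_vec n" "K *\<^sub>v y = c" for y
  proof -
    show yx: "y - x \<in> carrier_vec n" using x y by simp
    show Kyx: "K *\<^sub>v (y - x) = 0\<^sub>v k"
      using mult_minus_distrib_mat_vec[OF K y(1) x] y Kx c by simp
    have "x + (y - x) = y" using x y by (intro eq_vecI) auto
    then show "y \<bullet> (Q *\<^sub>v y) = x \<bullet> (Q *\<^sub>v x) + (y - x) \<bullet> (Q *\<^sub>v (y - x))"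
      using quadratic_form_add[OF Q x yx] orth[OF yx Kyx] by simp
  qed
  show ?thesis
  proof (rule ex1I[of _ x])
    show "x \<in> carrier_vec n \<and> K *\<^sub>v x = c \<and>
      (\<forall>y\<in>carrier_vec n. K *\<^sub>v y = c \<longrightarrow> x \<bullet> (Q *\<^sub>v x) \<le> y \<bullet> (Q *\<^sub>v y))"
    proof (intro conjI ballI impI)
      fix y assume "y \<in> carrier_vec n" "K *\<^sub>v y = c"
      then show "x \<bullet> (Q *\<^sub>v x) \<le> y \<bullet> (Q *\<^sub>v y)" using diff(1,3) psd by simp
    qed (rule x Kx)+
    fix y
    assume asm: "y \<in> carrier_vec n \<and> K *\<^sub>v y = c \<and>
      (\<forall>u\<in>carrier_vec n. K *\<^sub>v u = c \<longrightarrow> y \<bullet> (Q *\<^sub>v y) \<le> u \<bullet> (Q *\<^sub>v u))"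
    define h where "h = y - x"
    have h: "h \<in> carrier_vec n" "K *\<^sub>v h = 0\<^sub>v k"
      and val: "y \<bullet> (Q *\<^sub>v y) = x \<bullet> (Q *\<^sub>v x) + h \<bullet> (Q *\<^sub>v h)"
      using diff[of y] asm by (simp_all add: h_def)
    have "y \<bullet> (Q *\<^sub>v y) \<le> x \<bullet> (Q *\<^sub>v x)" using asm x Kx by blast
    then have "h \<bullet> (Q *\<^sub>v h) = 0" using val psd[OF h(1)] by simp
    then have "Q *\<^sub>v h = 0\<^sub>v n" using psd_form_zero_imp_kernel[OF Q _ h(1)] psd by simp
    moreover have "transpose_mat K *\<^sub>v 0\<^sub>v k = 0\<^sub>v n" using KT by auto
    ultimately have "?A *\<^sub>v (h @\<^sub>v 0\<^sub>v k) = 0\<^sub>v n @\<^sub>v 0\<^sub>v k" using A_mult[OF h(1)] h by simp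
    moreover have "?A *\<^sub>v (0\<^sub>v n @\<^sub>v 0\<^sub>v k) = 0\<^sub>v n @\<^sub>v 0\<^sub>v k"
    proof -
      have "Q *\<^sub>v 0\<^sub>v n = 0\<^sub>v n" "K *\<^sub>v 0\<^sub>v n = 0\<^sub>v k" using Q K by auto
      then show ?thesis using A_mult[of "0\<^sub>v n" "0\<^sub>v k"] \<open>transpose_mat K *\<^sub>v 0\<^sub>v k = 0\<^sub>v n\<close> by simp
    qed
    ultimately have "h @\<^sub>v 0\<^sub>v k = 0\<^sub>v n @\<^sub>v 0\<^sub>v k"
      using invertible_mat_solve[OF A inv, of "0\<^sub>v n @\<^sub>v 0\<^sub>v k"] h
      by (metis append_carrier_vec zero_carrier_vec)
    then have "h = 0\<^sub>v n" using h by (metis append_vec_eq zero_carrier_vec)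
    show "y = x"
    proof (rule eq_vecI)
      fix i assume "i < dim_vec x"
      then have "i < n" using x by simp
      then have "(y - x) $ i = 0" using \<open>h = 0\<^sub>v n\<close> by (simp add: h_def)
      then show "y $ i = x $ i" using \<open>i < n\<close> x asm by simp
    qed (use asm x in auto)
  qed
qed

section \<open>Unique solvability of the optimization problem\<close>

lemma objective_nonneg:
  assumes "\<forall>\<eta>\<in>{0..pi}. \<gamma> \<eta> \<ge> 0"
  shows "0 \<le> objective \<gamma> M d a b"
  unfolding objective_def set_lebesgue_integral_def
  using assms by (intro Bochner_Integration.integral_nonneg) (auto simp: indicator_def)

lemma Kmat_carrier: "Kmat M d p \<in> carrier_mat (d + p + 2) (2 * (2 * M + 1))"
  by (simp add: Kmat_def)

lemma optimal_iff_minimizer: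
  assumes int: "set_integrable lebesgue {0..pi} \<gamma>"
    and a: "a \<in> carrier_vec (2 * M + 1)" and b: "b \<in> carrier_vec (2 * M + 1)"
  shows "optimal \<gamma> M d p a b \<longleftrightarrow>
    Kmat M d p *\<^sub>v (a @\<^sub>v b) = unit_vec (d + p + 2) (d + p + 1) \<and>
    (\<forall>y\<in>carrier_vec (2 * (2 * M + 1)). Kmat M d p *\<^sub>v y = unit_vec (d + p + 2) (d + p + 1) \<longrightarrow>
      (a @\<^sub>v b) \<bullet> (Qmat \<gamma> M d *\<^sub>v (a @\<^sub>v b)) \<le> y \<bullet> (Qmat \<gamma> M d *\<^sub>v y))"
    (is "_ \<longleftrightarrow> ?K (a @\<^sub>v b) \<and> (\<forall>y\<in>_. ?K y \<longrightarrow> _ \<le> ?q y)")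
proof -
  let ?N = "2 * M + 1"
  have split: "(\<forall>y\<in>carrier_vec (2 * ?N). P y) \<longleftrightarrow>
      (\<forall>a'\<in>carrier_vec ?N. \<forall>b'\<in>carrier_vec ?N. P (a' @\<^sub>v b'))" for P :: "real vec \<Rightarrow> bool"
  proof (intro iffI ballI)
    fix y :: "real vec"
    assume *: "\<forall>a'\<in>carrier_vec ?N. \<forall>b'\<in>carrier_vec ?N. P (a' @\<^sub>v b')"
      and "y \<in> carrier_vec (2 * ?N)"
    then have "y \<in> carrier_vec (?N + ?N)" by (simp add: mult_2)
    then have "vec_first y ?N @\<^sub>v vec_last y ?N = y" by (rule vec_first_last_append)
    moreover have "P (vec_first y ?N @\<^sub>v vec_last y ?N)"
      using * vec_first_carrier vec_last_carrier by blast
    ultimately show "P y" by simp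
  next
    fix a' b' :: "real vec"
    assume *: "\<forall>y\<in>carrier_vec (2 * ?N). P y" "a' \<in> carrier_vec ?N" "b' \<in> carrier_vec ?N"
    then have "a' @\<^sub>v b' \<in> carrier_vec (?N + ?N)" by (intro append_carrier_vec)
    then show "P (a' @\<^sub>v b')" using *(1) by (simp add: mult_2)
  qed
  have "optimal \<gamma> M d p a b \<longleftrightarrow> feasible M d p a b \<and> (\<forall>a'\<in>carrier_vec ?N. \<forall>b'\<in>carrier_vec ?N.
      feasible M d p a' b' \<longrightarrow> objective \<gamma> M d a b \<le> objective \<gamma> M d a' b')"
    unfolding optimal_def by (auto simp: feasible_def)
  also have "\<dots> \<longleftrightarrow> ?K (a @\<^sub>v b) \<and> (\<forall>a'\<in>carrier_vec ?N. \<forall>b'\<in>carrier_vec ?N.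
      ?K (a' @\<^sub>v b') \<longrightarrow> ?q (a @\<^sub>v b) \<le> ?q (a' @\<^sub>v b'))"
    using feasible_iff_Kmat[of _ M _ d p] objective_eq_Qmat[OF int, of _ M _ d] a b by auto
  finally show ?thesis unfolding split .
qed

lemma ex1_optimal:
  assumes int: "set_integrable lebesgue {0..pi} \<gamma>"
    and nonneg: "\<forall>\<eta>\<in>{0..pi}. \<gamma> \<eta> \<ge> 0"
    and inv: "invertible_mat (KKT_mat \<gamma> M d p)"
  shows "\<exists>!(a, b). optimal \<gamma> M d p a b"
proof -
  let ?N = "2 * M + 1"
  let ?c = "unit_vec (d + p + 2) (d + p + 1) :: real vec"
  define minimizer where "minimizer x \<longleftrightarrow> x \<in> carrier_vec (2 * ?N) \<and> Kmat M d p *\<^sub>v x = ?c \<and>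
    (\<forall>y\<in>carrier_vec (2 * ?N). Kmat M d p *\<^sub>v y = ?c \<longrightarrow>
      x \<bullet> (Qmat \<gamma> M d *\<^sub>v x) \<le> y \<bullet> (Qmat \<gamma> M d *\<^sub>v y))" for x
  have decomp: "\<exists>a b. x = a @\<^sub>v b \<and> a \<in> carrier_vec ?N \<and> b \<in> carrier_vec ?N"
    if "x \<in> carrier_vec (2 * ?N)" for x :: "real vec"
  proof -
    have "x \<in> carrier_vec (?N + ?N)" using that by (simp add: mult_2)
    then have "x = vec_first x ?N @\<^sub>v vec_last x ?N" by (rule vec_first_last_append[symmetric])
    then show ?thesis using vec_first_carrier vec_last_carrier by blast
  qed
  have psd: "0 \<le> x \<bullet> (Qmat \<gamma> M d *\<^sub>v x)" if "x \<in> carrier_vec (2 * ?N)" for x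
    using decomp[OF that] objective_eq_Qmat[OF int] objective_nonneg[OF nonneg] by metis
  have ex1: "\<exists>!x. minimizer x"
    unfolding minimizer_def
    by (rule invertible_KKT_imp_unique_minimizer[OF Qmat_carrier Qmat_symmetric psd Kmat_carrier
          inv[unfolded KKT_mat_def] unit_vec_carrier])
  have iff: "optimal \<gamma> M d p a b \<longleftrightarrow>
      a \<in> carrier_vec ?N \<and> b \<in> carrier_vec ?N \<and> minimizer (a @\<^sub>v b)" for a b
  proof (cases "a \<in> carrier_vec ?N \<and> b \<in> carrier_vec ?N")
    case True
    then have "a @\<^sub>v b \<in> carrier_vec (?N + ?N)" by (intro append_carrier_vec) auto
    then have "a @\<^sub>v b \<in> carrier_vec (2 * ?N)" by (simp add: mult_2)
    then show ?thesis using True optimal_iff_minimizer[OF int, of a M b d p] unfolding minimizer_def by blast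
  next
    case False
    then show ?thesis by (auto simp: optimal_def feasible_def)
  qed
  obtain a b where ab: "minimizer (a @\<^sub>v b)" "a \<in> carrier_vec ?N" "b \<in> carrier_vec ?N"
    using ex1 decomp unfolding minimizer_def by metis
  show ?thesis
  proof (rule ex1I[of _ "(a, b)"])
    show "case (a, b) of (a, b) \<Rightarrow> optimal \<gamma> M d p a b" using ab iff by simp
    fix y assume "case y of (a, b) \<Rightarrow> optimal \<gamma> M d p a b"
    then obtain a' b' where y: "y = (a', b')" "optimal \<gamma> M d p a' b'" by (cases y) auto
    then have "a' @\<^sub>v b' = a @\<^sub>v b" "a' \<in> carrier_vec ?N" using ex1 ab(1) iff by blast+
    then show "y = (a, b)" using y ab by (metis append_vec_eq)
  qed
qed

section \<open>Reflection symmetry\<close>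

lemma exchange_mat_carrier: "exchange_mat N \<in> carrier_mat N N"
  by (simp add: exchange_mat_def)

lemma exchange_mat_scalar_prod:
  assumes "v \<in> carrier_vec N" "w \<in> carrier_vec N"
  shows "v \<bullet> (exchange_mat N *\<^sub>v w) = (exchange_mat N *\<^sub>v v) \<bullet> w"
proof -
  have "transpose_mat (exchange_mat N) = exchange_mat N"
    by (rule eq_matI) (auto simp: exchange_mat_def)
  then show ?thesis
    using transpose_vec_mult_scalar[OF exchange_mat_carrier assms(2,1)] by simp
qed

lemma offset_reflect: "i \<le> 2 * M \<Longrightarrow> offset M (2 * M - i) = - offset M i"
  by (simp add: offset_def)

lemma exchange_mat_Cvec: "exchange_mat (2 * M + 1) *\<^sub>v Cvec M \<eta> = Cvec M \<eta>"
  by (subst exchange_mat_mult_vec) (auto simp: Cvec_def offset_reflect)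

lemma exchange_mat_Svec: "exchange_mat (2 * M + 1) *\<^sub>v Svec M \<eta> = - Svec M \<eta>"
  by (subst exchange_mat_mult_vec) (auto simp: Svec_def offset_reflect)

lemma moment_exchange_mat:
  assumes "v \<in> carrier_vec (2 * M + 1)"
  shows "(\<Sum>i<2 * M + 1. offset M i ^ k * (exchange_mat (2 * M + 1) *\<^sub>v v) $ i) =
    (-1) ^ k * (\<Sum>i<2 * M + 1. offset M i ^ k * v $ i)"
proof -
  have "(\<Sum>i<2 * M + 1. offset M i ^ k * (exchange_mat (2 * M + 1) *\<^sub>v v) $ i) =
      (\<Sum>i<2 * M + 1. (-1) ^ k * (offset M (2 * M + 1 - Suc i) ^ k * v $ (2 * M + 1 - Suc i)))"
    unfolding exchange_mat_mult_vec[OF assms]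
    by (intro sum.cong refl) (simp add: offset_reflect power_minus[of "offset M _" k])
  also have "\<dots> = (\<Sum>i<2 * M + 1. (-1) ^ k * (offset M i ^ k * v $ i))"
    by (rule sum.nat_diff_reindex)
  finally show ?thesis unfolding sum_distrib_left .
qed

lemma objective_reflect:
  assumes a: "a \<in> carrier_vec (2 * M + 1)" and b: "b \<in> carrier_vec (2 * M + 1)"
  shows "objective \<gamma> M d (- (exchange_mat (2 * M + 1) *\<^sub>v a)) (exchange_mat (2 * M + 1) *\<^sub>v b) =
    objective \<gamma> M d a b"
proof -
  let ?J = "exchange_mat (2 * M + 1)"
  have C: "Cvec M \<eta> \<in> carrier_vec (2 * M + 1)" and S: "Svec M \<eta> \<in> carrier_vec (2 * M + 1)" for \<eta>
    by (simp_all add: Cvec_def Svec_def)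
  have J: "?J *\<^sub>v a \<in> carrier_vec (2 * M + 1)" "?J *\<^sub>v b \<in> carrier_vec (2 * M + 1)"
    using a b exchange_mat_carrier[of "2 * M + 1"] by auto
  have even: "Cvec M \<eta> \<bullet> (?J *\<^sub>v v) = Cvec M \<eta> \<bullet> v"
    and odd: "Svec M \<eta> \<bullet> (?J *\<^sub>v v) = - (Svec M \<eta> \<bullet> v)"
    if "v \<in> carrier_vec (2 * M + 1)" for v \<eta>
    using that C[of \<eta>] S[of \<eta>]
    by (simp_all add: exchange_mat_scalar_prod[where N = "2 * M + 1", simplified]
        exchange_mat_Cvec[simplified] exchange_mat_Svec[simplified])
  have neg: "v \<bullet> (- (?J *\<^sub>v a)) = - (v \<bullet> (?J *\<^sub>v a))" if "v \<in> carrier_vec (2 * M + 1)" for v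
    by (intro scalar_prod_uminus_right) (simp only: carrier_vecD[OF that] carrier_vecD[OF J(1)])
  have flip: "(- x + - y)\<^sup>2 = (x + y)\<^sup>2" for x y :: real
    by (simp add: power2_eq_square algebra_simps)
  show ?thesis
    unfolding objective_def neg[OF C] neg[OF S] even[OF a] even[OF b] odd[OF a] odd[OF b]
      mult_minus_right flip minus_minus ..
qed

lemma feasible_reflect:
  assumes d: "odd d" and f: "feasible M d p a b"
  shows "feasible M d p (- (exchange_mat (2 * M + 1) *\<^sub>v a)) (exchange_mat (2 * M + 1) *\<^sub>v b)"
proof -
  let ?N = "2 * M + 1"
  let ?J = "exchange_mat ?N"
  have a: "a \<in> carrier_vec ?N" and b: "b \<in> carrier_vec ?N" and bM: "b $ M = 1"
    using f by (auto simp: feasible_def)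
  have J: "?J *\<^sub>v a \<in> carrier_vec ?N" "?J *\<^sub>v b \<in> carrier_vec ?N"
    using a b exchange_mat_carrier[of ?N] by auto
  define \<mu> where "\<mu> v k = (\<Sum>i<?N. offset M i ^ k * v $ i)" for v k
  have reflect: "\<mu> (?J *\<^sub>v v) k = (-1) ^ k * \<mu> v k" if "v \<in> carrier_vec ?N" for v k
    unfolding \<mu>_def by (rule moment_exchange_mat[OF that])
  have reflect_neg: "\<mu> (- (?J *\<^sub>v a)) k = - ((-1) ^ k * \<mu> a k)" for k
  proof -
    have "\<mu> (- v) k = - \<mu> v k" if "v \<in> carrier_vec ?N" for v
      using that unfolding \<mu>_def sum_negf[symmetric] by (intro sum.cong refl) auto
    then show ?thesis using J(1) reflect[OF a] by simp
  qed
  have mixed: "(\<Sum>i<?N. offset M i ^ (d + r) / fact (d + r) * v $ i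
      - offset M i ^ r / fact r * w $ i) = \<mu> v (d + r) / fact (d + r) - \<mu> w r / fact r" for v w r
    unfolding \<mu>_def by (simp only: sum_subtractf sum_divide_distrib times_divide_eq_left)
  have moments: "\<mu> a k = 0" if "k < d" for k
    using f that by (simp add: feasible_def \<mu>_def mult.commute)
  have mixed0: "\<mu> a (d + r) / fact (d + r) - \<mu> b r / fact r = 0" if "r \<le> p" for r
    using f that unfolding feasible_def mixed by blast
  have c1: "(\<Sum>i<?N. (- (?J *\<^sub>v a)) $ i * offset M i ^ k) = 0" if "k < d" for k
  proof -
    have "(\<Sum>i<?N. (- (?J *\<^sub>v a)) $ i * offset M i ^ k) = \<mu> (- (?J *\<^sub>v a)) k"
      unfolding \<mu>_def by (simp only: mult.commute)
    then show ?thesis using reflect_neg moments[OF that] by simp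
  qed
  have c2: "\<mu> (- (?J *\<^sub>v a)) (d + r) / fact (d + r) - \<mu> (?J *\<^sub>v b) r / fact r = 0" if "r \<le> p" for r
  proof -
    (* The parities of d + r and r differ; the minus sign in front of J a compensates for this. *)
    have "- ((-1) ^ (d + r)) = ((-1) ^ r :: real)" using d by (simp add: power_add)
    then have "\<mu> (- (?J *\<^sub>v a)) (d + r) = (-1) ^ r * \<mu> a (d + r)"
      using reflect_neg[of "d + r"] by (simp only: mult_minus_left[symmetric])
    then have "\<mu> (- (?J *\<^sub>v a)) (d + r) / fact (d + r) - \<mu> (?J *\<^sub>v b) r / fact r =
        (-1) ^ r * (\<mu> a (d + r) / fact (d + r) - \<mu> b r / fact r)"
      using reflect[OF b] by (simp add: right_diff_distrib)
    then show ?thesis using mixed0[OF that] by simp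
  qed
  have c3: "(?J *\<^sub>v b) $ M = 1" using bM exchange_mat_mult_vec[OF b] by simp
  show ?thesis
    unfolding feasible_def mixed uminus_carrier_vec by (intro conjI allI impI J c1 c2 c3)
qed

lemma optimal_reflect:
  assumes d: "odd d" and opt: "optimal \<gamma> M d p a b"
  shows "optimal \<gamma> M d p (- (exchange_mat (2 * M + 1) *\<^sub>v a)) (exchange_mat (2 * M + 1) *\<^sub>v b)"
proof -
  have f: "feasible M d p a b" using opt by (simp add: optimal_def)
  then have "objective \<gamma> M d (- (exchange_mat (2 * M + 1) *\<^sub>v a)) (exchange_mat (2 * M + 1) *\<^sub>v b) =
      objective \<gamma> M d a b"
    by (intro objective_reflect) (auto simp: feasible_def)
  then show ?thesis using opt feasible_reflect[OF d f] by (simp add: optimal_def)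
qed

theorem lemma3:
  fixes \<gamma> :: "real \<Rightarrow> real" and M d p :: nat
  assumes "odd d" and "M \<ge> 1"
    and "set_integrable lebesgue {0..pi} \<gamma>"
    and "\<forall>\<eta>\<in>{0..pi}. \<gamma> \<eta> \<ge> 0"
    and "invertible_mat (KKT_mat \<gamma> M d p)"
  shows "(\<exists>!(a, b). optimal \<gamma> M d p a b) \<and>
    (\<forall>a b. optimal \<gamma> M d p a b \<longrightarrow>
       exchange_mat (2 * M + 1) *\<^sub>v a = - a \<and> exchange_mat (2 * M + 1) *\<^sub>v b = b)"
proof (intro conjI allI impI)
  show ex1: "\<exists>!(a, b). optimal \<gamma> M d p a b"
    by (rule ex1_optimal[OF assms(3-5)])
  fix a b
  assume opt: "optimal \<gamma> M d p a b"
  have fixed: "(- (exchange_mat (2 * M + 1) *\<^sub>v a), exchange_mat (2 * M + 1) *\<^sub>v b) = (a, b)"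
    using ex1 opt optimal_reflect[OF assms(1) opt] by auto
  show "exchange_mat (2 * M + 1) *\<^sub>v a = - a"
    using fixed by (metis prod.inject uminus_uminus_vec)
  show "exchange_mat (2 * M + 1) *\<^sub>v b = b"
    using fixed by simp
qed

end
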